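(* Let $X$ be a non-empty compact convex subset of a Hausdorff topological vector space. Let $f:X\times X\to\mathbb{R}$ be a function such that (i) $f$ is pseudo-continuous on $X\times X$; (ii) for each $x\in X$, the function $f(x,\cdot)$ is quasi-concave on $X$. Then the minimax inequality \[ \min_{x\in X}\max_{y\in X} f(x,y)\leq \max_{x\in X} f(x,x) \] holds.
   Context: Vector spaces are real. A function $f:Z\to\mathbb{R}$ on a topological space $Z$ is upper pseudo-continuous if for all $x,y\in Z$ with $f(x)<f(y)$ there is a neighbourhood $V$ of $x$ with $f(x')<f(y)$ for all $x'\in V$. It is lower pseudo-continuous if $-f$ is upper pseudo-continuous, and pseudo-continuous if it is both. A function $g:X\to\mathbb{R}$ on a convex set $X$ is quasi-concave if $\{x\in X: g(x)\geq\lambda\}$ is convex for every $\lambda\in\mathbb{R}$. *)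

theory Defs
  imports "HOL-Analysis.Analysis"
begin

text \<open>Real topological vector spaces, not assumed Hausdorff. Joint continuity of addition is part
  of \<^class>\<open>topological_ab_group_add\<close>; that class also requires continuity of negation, which
  in this setting follows from continuity of scalar multiplication.\<close>

class real_tvs = real_vector + topological_ab_group_add +
  assumes tendsto_scaleR_Pair:
    "((\<lambda>p. fst p *\<^sub>R snd p) \<longlongrightarrow> c *\<^sub>R x) (nhds c \<times>\<^sub>F nhds x)"

instance real_normed_vector < real_tvs
proof
  fix c :: real and x :: 'a
  show "((\<lambda>p. fst p *\<^sub>R snd p) \<longlongrightarrow> c *\<^sub>R x) (nhds c \<times>\<^sub>F nhds x)"
    unfolding nhds_prod[symmetric]
    using tendsto_fst[OF filterlim_ident, of "(c,x)"] tendsto_snd[OF filterlim_ident, of "(c,x)"]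
    by (auto intro!: tendsto_scaleR)
qed

text \<open>In the following definitions a function on a subset is a total function of which only the
  values on the subset matter, and neighbourhoods are taken in the subspace topology.\<close>

definition upper_pseudo_continuous_on :: "'a::topological_space set \<Rightarrow> ('a \<Rightarrow> real) \<Rightarrow> bool" where
  "upper_pseudo_continuous_on Z f \<longleftrightarrow>
     (\<forall>x\<in>Z. \<forall>y\<in>Z. f x < f y \<longrightarrow>
        (\<exists>V. openin (top_of_set Z) V \<and> x \<in> V \<and> (\<forall>x'\<in>V. f x' < f y)))"

definition lower_pseudo_continuous_on :: "'a::topological_space set \<Rightarrow> ('a \<Rightarrow> real) \<Rightarrow> bool" where
  "lower_pseudo_continuous_on Z f \<longleftrightarrow> upper_pseudo_continuous_on Z (\<lambda>x. - f x)"

definition pseudo_continuous_on :: "'a::topological_space set \<Rightarrow> ('a \<Rightarrow> real) \<Rightarrow> bool" where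
  "pseudo_continuous_on Z f \<longleftrightarrow> upper_pseudo_continuous_on Z f \<and> lower_pseudo_continuous_on Z f"

definition quasi_concave_on :: "'a::real_vector set \<Rightarrow> ('a \<Rightarrow> real) \<Rightarrow> bool" where
  "quasi_concave_on X g \<longleftrightarrow> (\<forall>t::real. convex {x \<in> X. g x \<ge> t})"

text \<open>Maxima and minima are relations between a function and a value, so that asserting one
  includes that the value is attained.\<close>

definition is_max_on :: "'a set \<Rightarrow> ('a \<Rightarrow> real) \<Rightarrow> real \<Rightarrow> bool" where
  "is_max_on A g m \<longleftrightarrow> (\<exists>a\<in>A. g a = m) \<and> (\<forall>a\<in>A. g a \<le> m)"

definition is_min_on :: "'a set \<Rightarrow> ('a \<Rightarrow> real) \<Rightarrow> real \<Rightarrow> bool" where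
  "is_min_on A g m \<longleftrightarrow> (\<exists>a\<in>A. g a = m) \<and> (\<forall>a\<in>A. m \<le> g a)"

end

theory Submission
  imports Defs
begin

text \<open>
  This is Ky Fan's minimax inequality. Its usual semicontinuity hypothesis on \<open>f(\<cdot>, y)\<close> enters at
  a single level only: with \<open>M\<close> the maximum of \<open>f\<close> on the diagonal, the sets
  \<open>U y = {x. f (x, y) > M}\<close> have to be open in \<open>X\<close>. Pseudo-continuity controls the level sets of \<open>f\<close>
  only at levels that \<open>f\<close> attains, but \<open>M\<close> is such a level. For the same reason the
  maxima and the minimum exist: covering arguments for extreme values use attained levels only.

  Suppose no \<open>x\<close> satisfies \<open>f (x, y) \<le> M\<close> for all \<open>y\<close>. Then the sets \<open>U y\<close> cover \<open>X\<close>,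
  and by compactness finitely many of them do, say for \<open>y\<close> in a finite set \<open>A\<close>. Some
  point \<open>x\<close> then lies in the convex hull of those \<open>y\<close> in \<open>A\<close> with \<open>x \<in> U y\<close>
  (\<open>open_cover_hull_point\<close>). Quasi-concavity makes \<open>{y. f (x, y) > M}\<close> convex, so
  it contains \<open>x\<close>, that is \<open>f (x, x) > M\<close>, which contradicts the choice of \<open>M\<close>.

  The point \<open>x\<close> comes from Brouwer's theorem. A partition of unity subordinate to the finite cover
  assigns to each point of the hull barycentric weights, and \<open>x\<close> is a point that is reproduced by
  its own weights. The search for \<open>x\<close> thus takes place among finitely many real weights, whatever
  the topology of the space. As the number of weights depends on the cover, Brouwer's theorem is
  required for a dimension that is a number rather than a type; \<open>brouwer_unit_cube\<close> derives it
  from Kuhn's combinatorial lemma.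
\<close>

section \<open>Brouwer's theorem on a cube of arbitrary dimension\<close>

text \<open>The coordinates from \<open>n\<close> on are set to \<open>0\<close>, so that the cube of any dimension \<open>n\<close> is a
  compact subset of one fixed metric space of sequences.\<close>

definition unit_cube :: "nat \<Rightarrow> (nat \<Rightarrow> real) set" where
  "unit_cube n = {t. (\<forall>i<n. 0 \<le> t i \<and> t i \<le> 1) \<and> (\<forall>i\<ge>n. t i = 0)}"

lemma tendsto_coordinatewiseI:
  fixes x :: "'b \<Rightarrow> 'c \<Rightarrow> 'a::topological_space"
  assumes "\<And>i. ((\<lambda>k. x k i) \<longlongrightarrow> l i) F"
  shows "(x \<longlongrightarrow> l) F"
proof -
  have "limitin (product_topology (\<lambda>i. euclidean) UNIV) x l F"
    using assms by (simp add: limitin_componentwise)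
  then show ?thesis
    by (simp add: euclidean_product_topology)
qed

lemma continuous_on_coordinate: "continuous_on S (\<lambda>t. t i)"
  by (rule continuous_on_subset[OF continuous_on_product_coordinates subset_UNIV])

lemma compact_unit_cube: "compact (unit_cube n)"
proof -
  have eq: "unit_cube n = (\<Pi>\<^sub>E i\<in>UNIV. if i < n then {0..1} else {0})"
  proof -
    have "t i \<in> (if i < n then {0..1} else {0}) \<longleftrightarrow>
        (i < n \<longrightarrow> 0 \<le> t i \<and> t i \<le> 1) \<and> (i \<ge> n \<longrightarrow> t i = 0)" for t :: "nat \<Rightarrow> real" and i
      by auto
    then show ?thesis
      unfolding unit_cube_def PiE_UNIV_domain Pi_def by blast
  qed
  have "compactin (product_topology (\<lambda>i. euclidean) UNIV) (unit_cube n)"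
    unfolding eq compactin_PiE by auto
  then show ?thesis
    by (simp add: euclidean_product_topology)
qed

text \<open>Kuhn's lemma on the grid of mesh \<open>1 / p\<close>, with a grid point labelled in direction \<open>i\<close> by
  whether \<open>h\<close> moves its \<open>i\<close>-th coordinate up or down. A cell that shows both labels in every
  direction traps an approximate fixed point; the witnesses \<open>u\<close> and \<open>v\<close> may differ from one
  direction to another. Continuity enters only when \<open>p\<close> tends to infinity.\<close>

lemma kuhn_approximate_fixed_point:
  fixes h :: "(nat \<Rightarrow> real) \<Rightarrow> nat \<Rightarrow> real"
  assumes h: "\<And>t i. t \<in> unit_cube n \<Longrightarrow> i < n \<Longrightarrow> 0 \<le> h t i \<and> h t i \<le> 1"
    and p: "0 < p"
  shows "\<exists>z\<in>unit_cube n. \<forall>i<n. \<exists>u\<in>unit_cube n. \<exists>v\<in>unit_cube n.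
           (\<forall>j. \<bar>u j - z j\<bar> \<le> 1 / real p) \<and> (\<forall>j. \<bar>v j - z j\<bar> \<le> 1 / real p) \<and>
           u i \<le> h u i \<and> h v i \<le> v i"
proof -
  define e :: "(nat \<Rightarrow> nat) \<Rightarrow> nat \<Rightarrow> real"
    where "e x = (\<lambda>j. if j < n then real (x j) / real p else 0)" for x
  \<comment> \<open>Where \<open>h\<close> fixes the coordinate both labels would be correct, but Kuhn's lemma demands
    label 1 on the upper face; hence the condition \<open>x i < p\<close>.\<close>
  define label :: "(nat \<Rightarrow> nat) \<Rightarrow> nat \<Rightarrow> nat"
    where "label x i = (if x i < p \<and> e x i \<le> h (e x) i then 0 else 1)" for x i
  have e_cube: "e x \<in> unit_cube n" if "\<forall>i<n. x i \<le> p" for x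
  proof -
    have "0 \<le> e x i \<and> e x i \<le> 1" if "i < n" for i
      using \<open>\<forall>i<n. x i \<le> p\<close>[rule_format, OF that] p that by (simp add: e_def)
    moreover have "e x i = 0" if "n \<le> i" for i using that by (simp add: e_def)
    ultimately show ?thesis unfolding unit_cube_def by blast
  qed
  have label0: "e x i \<le> h (e x) i" if "label x i = 0" for x i
    using that by (auto simp: label_def split: if_splits)
  have label1: "h (e x) i \<le> e x i" if "\<forall>i<n. x i \<le> p" "i < n" "label x i \<noteq> 0" for x i
  proof (cases "x i = p")
    case True
    with that p h[OF e_cube[OF that(1)] that(2)] show ?thesis
      by (simp add: e_def)
  next
    case False
    with that have "x i < p" by (simp add: le_neq_implies_less)
    with that show ?thesis by (auto simp: label_def split: if_splits)
  qed
  obtain q where q: "\<forall>i<n. q i < p"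
    and rs: "\<forall>i<n. \<exists>r s. (\<forall>j<n. q j \<le> r j \<and> r j \<le> q j + 1) \<and>
               (\<forall>j<n. q j \<le> s j \<and> s j \<le> q j + 1) \<and> label r i \<noteq> label s i"
  proof (rule kuhn_lemma[OF p, of n label])
    show "\<forall>x. (\<forall>i<n. x i \<le> p) \<longrightarrow> (\<forall>i<n. label x i = 0 \<or> label x i = 1)"
      by (simp add: label_def)
    show "\<forall>x. (\<forall>i<n. x i \<le> p) \<longrightarrow> (\<forall>i<n. x i = 0 \<longrightarrow> label x i = 0)"
      using h[OF e_cube] p by (simp add: label_def e_def)
    show "\<forall>x. (\<forall>i<n. x i \<le> p) \<longrightarrow> (\<forall>i<n. x i = p \<longrightarrow> label x i = 1)"
      by (simp add: label_def)
  qed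
  have near: "\<bar>e r j - e q j\<bar> \<le> 1 / real p" if "\<forall>j<n. q j \<le> r j \<and> r j \<le> q j + 1" for r j
  proof (cases "j < n")
    case True
    with that have "q j \<le> r j" "r j \<le> q j + 1" by blast+
    then have "\<bar>real (r j) - real (q j)\<bar> \<le> 1" by linarith
    with True p show ?thesis
      by (simp add: e_def diff_divide_distrib[symmetric] divide_right_mono)
  qed (simp add: e_def)
  have inside: "\<forall>j<n. r j \<le> p" if "\<forall>j<n. q j \<le> r j \<and> r j \<le> q j + 1" for r
  proof (intro allI impI)
    fix j assume "j < n"
    then have "r j \<le> q j + 1" "q j < p" using that q by blast+
    then show "r j \<le> p" by linarith
  qed
  show ?thesis
  proof (rule bexI[of _ "e q"], intro allI impI)
    show "e q \<in> unit_cube n" using q less_imp_le by (intro e_cube) blast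
  next
    fix i assume i: "i < n"
    with rs obtain r s where r: "\<forall>j<n. q j \<le> r j \<and> r j \<le> q j + 1"
      and s: "\<forall>j<n. q j \<le> s j \<and> s j \<le> q j + 1" and ne: "label r i \<noteq> label s i"
      by blast
    have *: "\<exists>u\<in>unit_cube n. \<exists>v\<in>unit_cube n.
           (\<forall>j. \<bar>u j - e q j\<bar> \<le> 1 / real p) \<and> (\<forall>j. \<bar>v j - e q j\<bar> \<le> 1 / real p) \<and>
           u i \<le> h u i \<and> h v i \<le> v i"
      if r: "\<forall>j<n. q j \<le> r j \<and> r j \<le> q j + 1" and s: "\<forall>j<n. q j \<le> s j \<and> s j \<le> q j + 1"
        and "label r i = 0" "label s i \<noteq> 0" for r s
      using near[OF r] near[OF s] label0[OF that(3)] label1[OF inside[OF s] i that(4)]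
      by (intro bexI[OF _ e_cube[OF inside[OF r]]] bexI[OF _ e_cube[OF inside[OF s]]] conjI allI)
    show "\<exists>u\<in>unit_cube n. \<exists>v\<in>unit_cube n.
           (\<forall>j. \<bar>u j - e q j\<bar> \<le> 1 / real p) \<and> (\<forall>j. \<bar>v j - e q j\<bar> \<le> 1 / real p) \<and>
           u i \<le> h u i \<and> h v i \<le> v i"
    proof (cases "label r i = 0")
      case True
      with ne show ?thesis by (intro *[OF r s]) auto
    next
      case False
      with ne have "label s i = 0" by (auto simp: label_def split: if_splits)
      then show ?thesis using False by (intro *[OF s r])
    qed
  qed
qed

text \<open>By compactness, cells of vanishing mesh accumulate at a point \<open>t\<close>. In each direction the
  points of the cells that move up and those that move down both converge to \<open>t\<close>, so
  \<open>t\<close> moves neither way.\<close>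

theorem brouwer_unit_cube:
  fixes h :: "(nat \<Rightarrow> real) \<Rightarrow> nat \<Rightarrow> real"
  assumes cont: "\<And>i. i < n \<Longrightarrow> continuous_on (unit_cube n) (\<lambda>t. h t i)"
    and h: "\<And>t i. t \<in> unit_cube n \<Longrightarrow> i < n \<Longrightarrow> 0 \<le> h t i \<and> h t i \<le> 1"
  shows "\<exists>t\<in>unit_cube n. \<forall>i<n. h t i = t i"
proof -
  define pinched where "pinched z i d \<longleftrightarrow> (\<exists>u\<in>unit_cube n. \<exists>v\<in>unit_cube n.
      (\<forall>j. \<bar>u j - z j\<bar> \<le> d) \<and> (\<forall>j. \<bar>v j - z j\<bar> \<le> d) \<and> u i \<le> h u i \<and> h v i \<le> v i)"
    for z i and d :: real
  have "\<forall>k. \<exists>z. z \<in> unit_cube n \<and> (\<forall>i<n. pinched z i (1 / real (Suc k)))"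
    unfolding pinched_def Bex_def[symmetric]
    by (intro allI kuhn_approximate_fixed_point h) simp_all
  from choice[OF this] obtain z where z: "\<And>k. z k \<in> unit_cube n"
    and crossing: "\<And>k i. i < n \<Longrightarrow> pinched (z k) i (1 / real (Suc k))"
    by blast
  have "seq_compact (unit_cube n)"
    using compact_unit_cube by (rule compact_imp_seq_compact)
  with z obtain t r where t: "t \<in> unit_cube n" and r: "strict_mono r" and lim: "(z \<circ> r) \<longlonglongrightarrow> t"
    unfolding seq_compact_def by metis
  have lim_j: "(\<lambda>k. z (r k) j) \<longlonglongrightarrow> t j" for j
    using continuous_on_tendsto_compose[OF continuous_on_coordinate[of UNIV j] lim]
    by (simp add: comp_def)
  have mesh: "(\<lambda>k. 1 / real (Suc (r k))) \<longlonglongrightarrow> 0"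
    using LIMSEQ_subseq_LIMSEQ[OF lim_1_over_n[THEN LIMSEQ_Suc] r] by (simp add: comp_def)
  have near: "(\<lambda>k. w (r k)) \<longlonglongrightarrow> t"
    if "\<And>k j. \<bar>w k j - z k j\<bar> \<le> 1 / real (Suc k)" for w :: "nat \<Rightarrow> nat \<Rightarrow> real"
  proof (rule tendsto_coordinatewiseI)
    fix j
    have "(\<lambda>k. w (r k) j - z (r k) j) \<longlonglongrightarrow> 0"
      by (rule Lim_null_comparison[OF _ mesh]) (simp only: real_norm_def that eventually_True)
    from tendsto_add[OF this lim_j[of j]] show "(\<lambda>k. w (r k) j) \<longlonglongrightarrow> t j" by simp
  qed
  have "h t i = t i" if i: "i < n" for i
  proof (rule antisym)
    have lims: "(\<lambda>k. h (w (r k)) i) \<longlonglongrightarrow> h t i" "(\<lambda>k. w (r k) i) \<longlonglongrightarrow> t i"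
      if "\<And>k j. \<bar>w k j - z k j\<bar> \<le> 1 / real (Suc k)" "\<And>k. w k \<in> unit_cube n"
      for w :: "nat \<Rightarrow> nat \<Rightarrow> real"
      using continuous_on_tendsto_compose[OF cont[OF i] near[OF that(1)] t] that(2)
        continuous_on_tendsto_compose[OF continuous_on_coordinate[of UNIV i] near[OF that(1)]]
      by auto
    have "\<forall>k. \<exists>u. u \<in> unit_cube n \<and> (\<forall>j. \<bar>u j - z k j\<bar> \<le> 1 / real (Suc k)) \<and> u i \<le> h u i"
      using crossing[OF i] unfolding pinched_def by blast
    from choice[OF this] obtain u where u: "\<And>k. u k \<in> unit_cube n"
      "\<And>k j. \<bar>u k j - z k j\<bar> \<le> 1 / real (Suc k)" "\<And>k. u k i \<le> h (u k) i"
      by blast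
    have "\<forall>k. \<exists>v. v \<in> unit_cube n \<and> (\<forall>j. \<bar>v j - z k j\<bar> \<le> 1 / real (Suc k)) \<and> h v i \<le> v i"
      using crossing[OF i] unfolding pinched_def by blast
    from choice[OF this] obtain v where v: "\<And>k. v k \<in> unit_cube n"
      "\<And>k j. \<bar>v k j - z k j\<bar> \<le> 1 / real (Suc k)" "\<And>k. h (v k) i \<le> v k i"
      by blast
    show "h t i \<le> t i"
      using LIMSEQ_le[OF lims(1)[of v] lims(2)[of v]] v by blast
    show "t i \<le> h t i"
      using LIMSEQ_le[OF lims(2)[of u] lims(1)[of u]] u by blast
  qed
  with t show ?thesis by blast
qed

section \<open>Finite open covers of convex sets\<close>

lemma tendsto_scaleR_tvs:
  fixes g :: "'b \<Rightarrow> 'a::real_tvs"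
  assumes "(a \<longlongrightarrow> c) F" "(g \<longlongrightarrow> x) F"
  shows "((\<lambda>s. a s *\<^sub>R g s) \<longlongrightarrow> c *\<^sub>R x) F"
  using filterlim_compose[OF tendsto_scaleR_Pair filterlim_Pair[OF assms]] by simp

lemma continuous_on_scaleR_tvs:
  fixes y :: "'a::real_tvs"
  assumes "continuous_on S a"
  shows "continuous_on S (\<lambda>s. a s *\<^sub>R y)"
  using assms unfolding continuous_on_def by (auto intro: tendsto_scaleR_tvs)

text \<open>Every relatively open subset of a metric space is the positivity set of a distance function;
  these functions become the partition of unity below. The distance to an empty set is \<open>0\<close> by
  convention, so the whole space has to be treated apart.\<close>

lemma openin_positivity_set:
  fixes C :: "'a::metric_space set"
  assumes "openin (top_of_set C) V"
  obtains \<phi> :: "'a \<Rightarrow> real" where "continuous_on C \<phi>" "\<And>t. \<phi> t \<ge> 0"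
    "\<And>t. t \<in> C \<Longrightarrow> \<phi> t > 0 \<longleftrightarrow> t \<in> V"
proof -
  obtain T where T: "open T" "V = C \<inter> T"
    using assms by (auto simp: openin_open)
  show thesis
  proof (cases "T = UNIV")
    case True
    with T that[of "\<lambda>_. 1"] show thesis by simp
  next
    case False
    show thesis
    proof (rule that[of "\<lambda>t. infdist t (- T)"])
      fix t assume "t \<in> C"
      then show "infdist t (- T) > 0 \<longleftrightarrow> t \<in> V"
        using T False in_closed_iff_infdist_zero[of "- T" t] infdist_nonneg[of t "- T"]
        by (auto simp: less_le)
    qed (auto intro: continuous_intros simp: infdist_nonneg)
  qed
qed

text \<open>The Knaster--Kuratowski--Mazurkiewicz theorem for the complements of the sets \<open>U y\<close>. The partition of unity is
  built on the cube that parametrises the convex hull of \<open>A\<close>, because the cube is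
  metrisable whereas \<open>X\<close> need not be.\<close>

lemma open_cover_hull_point:
  fixes X :: "'a::real_tvs set"
  assumes "convex X" "X \<noteq> {}" "finite A" "A \<subseteq> X"
    and U: "\<And>y. y \<in> A \<Longrightarrow> openin (top_of_set X) (U y)"
    and cover: "X \<subseteq> (\<Union>y\<in>A. U y)"
  shows "\<exists>x\<in>X. x \<in> convex hull {y \<in> A. x \<in> U y}"
proof -
  have "A \<noteq> {}" using assms by auto
  with \<open>finite A\<close> obtain n where n: "card A = Suc n"
    by (metis card_0_eq not0_implies_Suc)
  obtain y where "bij_betw y {..<card A} A"
    using \<open>finite A\<close> ex_bij_betw_nat_finite lessThan_atLeast0 by metis
  then have y: "y ` {..n} = A"
    by (auto simp: n lessThan_Suc_atMost bij_betw_def)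
  then have yX: "y i \<in> X" if "i \<le> n" for i using that \<open>A \<subseteq> X\<close> by auto
  \<comment> \<open>The cube is retracted onto the simplex of weights of sum at most 1 for the first \<open>n\<close> points;
    the remaining weight goes to \<open>y n\<close>.\<close>
  define \<rho> :: "(nat \<Rightarrow> real) \<Rightarrow> nat \<Rightarrow> real"
    where "\<rho> t i = t i / max 1 (\<Sum>i<n. t i)" for t i
  define x where "x t = (\<Sum>i<n. \<rho> t i *\<^sub>R y i) + (1 - (\<Sum>i<n. \<rho> t i)) *\<^sub>R y n" for t
  have sum_\<rho>: "(\<Sum>i<n. \<rho> t i) \<le> 1" for t
    by (simp add: \<rho>_def sum_divide_distrib[symmetric])
  have x_conv: "x t \<in> X" if "t \<in> unit_cube n" for t
  proof -
    have "(\<Sum>i\<le>n. (if i < n then \<rho> t i else 1 - (\<Sum>i<n. \<rho> t i)) *\<^sub>R y i) \<in> X"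
    proof (rule convex_sum[OF _ \<open>convex X\<close>])
      show "(\<Sum>i\<le>n. if i < n then \<rho> t i else 1 - (\<Sum>i<n. \<rho> t i)) = 1"
        by (simp add: lessThan_Suc_atMost[symmetric])
    qed (use that sum_\<rho> yX in \<open>auto simp: unit_cube_def \<rho>_def\<close>)
    then show ?thesis by (simp add: x_def lessThan_Suc_atMost[symmetric])
  qed
  have cont_\<rho>: "continuous_on (unit_cube n) (\<lambda>t. \<rho> t i)" for i
    unfolding \<rho>_def by (intro continuous_intros continuous_on_coordinate) auto
  have cont_x: "continuous_on (unit_cube n) x"
    unfolding x_def by (intro continuous_intros continuous_on_scaleR_tvs cont_\<rho>)
  have "\<exists>\<phi>. continuous_on (unit_cube n) \<phi> \<and> (\<forall>t. (0::real) \<le> \<phi> t) \<and>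
      (\<forall>t\<in>unit_cube n. 0 < \<phi> t \<longleftrightarrow> x t \<in> U (y i))" if "i \<le> n" for i
  proof -
    have "openin (top_of_set (unit_cube n)) (unit_cube n \<inter> x -` U (y i))"
      by (rule continuous_openin_preimage[OF cont_x, of X]) (use x_conv U y that in auto)
    then obtain \<phi> :: "(nat \<Rightarrow> real) \<Rightarrow> real" where "continuous_on (unit_cube n) \<phi>" "\<And>t. 0 \<le> \<phi> t"
      "\<And>t. t \<in> unit_cube n \<Longrightarrow> 0 < \<phi> t \<longleftrightarrow> t \<in> unit_cube n \<inter> x -` U (y i)"
      by (rule openin_positivity_set) auto
    then show ?thesis by (intro exI[of _ \<phi>]) auto
  qed
  then obtain \<phi> where cont_\<phi>: "\<And>i. i \<le> n \<Longrightarrow> continuous_on (unit_cube n) (\<phi> i)"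
    and \<phi>_nonneg: "\<And>i t. i \<le> n \<Longrightarrow> (0::real) \<le> \<phi> i t"
    and \<phi>_pos: "\<And>i t. i \<le> n \<Longrightarrow> t \<in> unit_cube n \<Longrightarrow> 0 < \<phi> i t \<longleftrightarrow> x t \<in> U (y i)"
    by metis
  have total_pos: "0 < (\<Sum>i\<le>n. \<phi> i t)" if t: "t \<in> unit_cube n" for t
  proof -
    obtain i where "i \<le> n" "x t \<in> U (y i)"
      using x_conv[OF t] cover y by blast
    with \<phi>_nonneg \<phi>_pos t show ?thesis
      by (intro sum_pos2[of _ i]) auto
  qed
  define \<beta> where "\<beta> t i = \<phi> i t / (\<Sum>i\<le>n. \<phi> i t)" for t i
  have \<beta>_nonneg: "0 \<le> \<beta> t i" if "i \<le> n" for t i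
    using that unfolding \<beta>_def by (intro divide_nonneg_nonneg sum_nonneg \<phi>_nonneg) auto
  have sum_\<beta>: "(\<Sum>i\<le>n. \<beta> t i) = 1" if "t \<in> unit_cube n" for t
    using total_pos[OF that] by (simp add: \<beta>_def sum_divide_distrib[symmetric])
  have sum_\<beta>_last: "(\<Sum>i<n. \<beta> t i) = 1 - \<beta> t n" if "t \<in> unit_cube n" for t
    using sum_\<beta>[OF that] by (simp add: lessThan_Suc_atMost[symmetric])
  have "\<exists>t\<in>unit_cube n. \<forall>i<n. \<beta> t i = t i"
  proof (rule brouwer_unit_cube)
    show "continuous_on (unit_cube n) (\<lambda>t. \<beta> t i)" if "i < n" for i
      unfolding \<beta>_def using that total_pos
      by (intro continuous_intros cont_\<phi>) (auto simp: less_imp_neq[symmetric])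
    show "0 \<le> \<beta> t i \<and> \<beta> t i \<le> 1" if "t \<in> unit_cube n" "i < n" for t i
      using member_le_sum[of i "{..n}" "\<beta> t"] \<beta>_nonneg sum_\<beta>[OF that(1)] that by auto
  qed
  then obtain t where t: "t \<in> unit_cube n" and fixed: "\<And>i. i < n \<Longrightarrow> \<beta> t i = t i"
    by blast
  \<comment> \<open>A fixed point consists of weights, so it lies in the simplex, where the retraction is the
    identity.\<close>
  have "(\<Sum>i<n. t i) \<le> 1"
    using sum_\<beta>_last[OF t] \<beta>_nonneg[of n t] fixed by simp
  then have "\<rho> t i = t i" for i by (simp add: \<rho>_def max_absorb1)
  then have "x t = (\<Sum>i\<le>n. \<beta> t i *\<^sub>R y i)"
    using fixed sum_\<beta>_last[OF t] by (simp add: x_def lessThan_Suc_atMost[symmetric])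
  also have "\<dots> = (\<Sum>i\<in>{i. i \<le> n \<and> 0 < \<beta> t i}. \<beta> t i *\<^sub>R y i)"
    using \<beta>_nonneg by (intro sum.mono_neutral_right) (auto simp: less_le)
  also have "\<dots> \<in> convex hull {z \<in> A. x t \<in> U z}"
  proof (rule convex_sum[OF _ convex_convex_hull])
    show "(\<Sum>i\<in>{i. i \<le> n \<and> 0 < \<beta> t i}. \<beta> t i) = 1"
      unfolding sum_\<beta>[OF t, symmetric]
      using \<beta>_nonneg by (intro sum.mono_neutral_left) (auto simp: less_le)
    show "y i \<in> convex hull {z \<in> A. x t \<in> U z}" if "i \<in> {i. i \<le> n \<and> 0 < \<beta> t i}" for i
      using that total_pos[OF t] \<phi>_pos[OF _ t] y
      by (intro hull_inc) (auto simp: \<beta>_def zero_less_divide_iff)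
  qed auto
  finally show ?thesis using x_conv[OF t] by blast
qed

section \<open>Ky Fan's inequality\<close>

lemma convex_strict_superlevel:
  assumes "quasi_concave_on X g"
  shows "convex {y \<in> X. g y > c}"
proof (rule convexI)
  fix a b and u v :: real
  assume ab: "a \<in> {y \<in> X. g y > c}" "b \<in> {y \<in> X. g y > c}"
    and uv: "0 \<le> u" "0 \<le> v" "u + v = 1"
  have "convex {y \<in> X. g y \<ge> min (g a) (g b)}"
    using assms by (simp add: quasi_concave_on_def)
  from convexD[OF this _ _ uv, of a b] ab show "u *\<^sub>R a + v *\<^sub>R b \<in> {y \<in> X. g y > c}"
    by auto
qed

text \<open>Openness is required at the single level \<open>c\<close> that bounds \<open>f\<close> on the diagonal, instead of lower
  semicontinuity of \<open>f(\<cdot>, y)\<close>; for a pseudo-continuous \<open>f\<close> that level can be chosen among the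
  values of \<open>f\<close>. If the conclusion fails, these open sets cover \<open>X\<close>, and the point \<open>x\<close> given by
  \<open>open_cover_hull_point\<close> lies in the convex set \<open>{y \<in> X. f (x, y) > c}\<close>, so the diagonal bound is
  violated at \<open>x\<close>.\<close>

theorem ky_fan_inequality:
  fixes X :: "'a::real_tvs set"
  assumes "X \<noteq> {}" "compact X" "convex X"
    and opn: "\<And>y. y \<in> X \<Longrightarrow> openin (top_of_set X) {x \<in> X. f (x, y) > c}"
    and qc: "\<And>x. x \<in> X \<Longrightarrow> quasi_concave_on X (\<lambda>y. f (x, y))"
    and diag: "\<And>x. x \<in> X \<Longrightarrow> f (x, x) \<le> c"
  shows "\<exists>x\<in>X. \<forall>y\<in>X. f (x, y) \<le> c"
proof (rule ccontr)
  assume none: "\<not> ?thesis"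
  define U where "U y = {x \<in> X. f (x, y) > c}" for y
  have "\<forall>V\<in>U ` X. openin (top_of_set X) V" "X \<subseteq> \<Union>(U ` X)"
    using opn none by (auto simp: U_def not_le)
  then obtain \<D> where "\<D> \<subseteq> U ` X" "finite \<D>" "X \<subseteq> \<Union>\<D>"
    using \<open>compact X\<close> unfolding compact_eq_openin_cover by metis
  then obtain A where A: "A \<subseteq> X" "finite A" "X \<subseteq> (\<Union>y\<in>A. U y)"
    by (metis finite_subset_image)
  then obtain x where x: "x \<in> X" "x \<in> convex hull {y \<in> A. x \<in> U y}"
    using open_cover_hull_point[of X A U] assms by (auto simp: U_def)
  have "convex hull {y \<in> A. x \<in> U y} \<subseteq> {y \<in> X. f (x, y) > c}"
    using A by (intro hull_minimal convex_strict_superlevel qc x) (auto simp: U_def)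
  with x diag show False by (auto simp: not_le[symmetric])
qed

section \<open>Pseudo-continuous functions\<close>

lemma upper_pseudo_continuous_on_openin:
  assumes "upper_pseudo_continuous_on Z f" "y \<in> Z"
  shows "openin (top_of_set Z) {x \<in> Z. f x < f y}"
proof (subst openin_subopen, intro ballI)
  fix x assume "x \<in> {x \<in> Z. f x < f y}"
  with assms obtain V where "openin (top_of_set Z) V" "x \<in> V" "\<forall>x'\<in>V. f x' < f y"
    unfolding upper_pseudo_continuous_on_def by blast
  then show "\<exists>T. openin (top_of_set Z) T \<and> x \<in> T \<and> T \<subseteq> {x \<in> Z. f x < f y}"
    using openin_imp_subset by (intro exI[of _ V]) blast
qed

lemma lower_pseudo_continuous_on_openin:
  assumes "lower_pseudo_continuous_on Z f" "y \<in> Z"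
  shows "openin (top_of_set Z) {x \<in> Z. f x > f y}"
  using upper_pseudo_continuous_on_openin[of Z "\<lambda>x. - f x" y] assms
  by (simp add: lower_pseudo_continuous_on_def)

lemma upper_pseudo_continuous_on_compose:
  assumes "upper_pseudo_continuous_on Z f" "continuous_on W k" "k \<in> W \<rightarrow> Z"
  shows "upper_pseudo_continuous_on W (\<lambda>w. f (k w))"
  unfolding upper_pseudo_continuous_on_def
proof (intro ballI impI)
  fix a b assume "a \<in> W" "b \<in> W" "f (k a) < f (k b)"
  moreover from this have "openin (top_of_set Z) {x \<in> Z. f x < f (k b)}"
    using assms by (intro upper_pseudo_continuous_on_openin) auto
  moreover from this have "openin (top_of_set W) (W \<inter> k -` {x \<in> Z. f x < f (k b)})"
    using continuous_openin_preimage[OF assms(2,3)] by blast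
  ultimately show "\<exists>V. openin (top_of_set W) V \<and> a \<in> V \<and> (\<forall>x'\<in>V. f (k x') < f (k b))"
    using assms(3) by (intro exI[of _ "W \<inter> k -` {x \<in> Z. f x < f (k b)}"] conjI) auto
qed

text \<open>If no maximum were attained, every point would lie in an open set \<open>{x. f x < f y}\<close>; of finitely
  many such sets covering \<open>Z\<close>, none contains the \<open>y\<close> with the largest value.\<close>

lemma upper_pseudo_continuous_attains_max:
  assumes "compact Z" "Z \<noteq> {}" "upper_pseudo_continuous_on Z f"
  shows "\<exists>m. is_max_on Z f m"
proof (rule ccontr)
  assume "\<not> ?thesis"
  then have none: "\<exists>y\<in>Z. f x < f y" if "x \<in> Z" for x
    using that unfolding is_max_on_def by (metis not_le)
  define L where "L y = {x \<in> Z. f x < f y}" for y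
  have "\<forall>V\<in>L ` Z. openin (top_of_set Z) V" "Z \<subseteq> \<Union>(L ` Z)"
    using none upper_pseudo_continuous_on_openin[OF assms(3)] by (auto simp: L_def)
  then obtain \<D> where "\<D> \<subseteq> L ` Z" "finite \<D>" "Z \<subseteq> \<Union>\<D>"
    using \<open>compact Z\<close> unfolding compact_eq_openin_cover by metis
  then obtain B where B: "B \<subseteq> Z" "finite B" "Z \<subseteq> (\<Union>y\<in>B. L y)"
    by (metis finite_subset_image)
  with \<open>Z \<noteq> {}\<close> have "B \<noteq> {}" by auto
  with \<open>finite B\<close> have "Max (f ` B) \<in> f ` B" by simp
  then obtain b where b: "b \<in> B" "f b = Max (f ` B)" by auto
  with B obtain y where "y \<in> B" "f b < f y" by (force simp: L_def)
  moreover from this \<open>finite B\<close> b have "f y \<le> f b" by simp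
  ultimately show False by simp
qed

text \<open>If \<open>g z < g x\<close>, both values are values of \<open>f\<close>, say \<open>f (z, w) < f (x, y)\<close>, because the maxima are
  attained. Keeping \<open>y\<close> fixed and moving \<open>x\<close> preserves this inequality, and \<open>g\<close> dominates
  \<open>f(\<cdot>, y)\<close>. On a compact set this is what makes \<open>g\<close> attain its minimum.\<close>

lemma lower_pseudo_continuous_on_partial_max:
  assumes lower: "lower_pseudo_continuous_on (X \<times> Y) f"
    and max: "\<And>x. x \<in> X \<Longrightarrow> is_max_on Y (\<lambda>y. f (x, y)) (g x)"
  shows "lower_pseudo_continuous_on X g"
  unfolding lower_pseudo_continuous_on_def upper_pseudo_continuous_on_def neg_less_iff_less
proof (intro ballI impI)
  fix x z assume x: "x \<in> X" and z: "z \<in> X" and less: "g z < g x"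
  obtain y where y: "y \<in> Y" "f (x, y) = g x" using max[OF x] by (auto simp: is_max_on_def)
  obtain w where w: "w \<in> Y" "f (z, w) = g z" using max[OF z] by (auto simp: is_max_on_def)
  define V where "V = X \<inter> (\<lambda>x'. (x', y)) -` {p \<in> X \<times> Y. f p > f (z, w)}"
  have "openin (top_of_set (X \<times> Y)) {p \<in> X \<times> Y. f p > f (z, w)}"
    using z w lower by (intro lower_pseudo_continuous_on_openin) auto
  then have "openin (top_of_set X) V"
    unfolding V_def using y
    by (intro continuous_openin_preimage[of X _ "X \<times> Y"] continuous_intros) auto
  moreover have "x \<in> V" using x y w less by (auto simp: V_def)
  moreover have "g z < g x'" if "x' \<in> V" for x'
    using that max[of x'] w by (force simp: V_def is_max_on_def)
  ultimately show "\<exists>V. openin (top_of_set X) V \<and> x \<in> V \<and> (\<forall>x'\<in>V. g z < g x')"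
    by blast
qed

theorem proposition4p2:
  fixes X :: "'a::{real_tvs, t2_space} set"
    and f :: "'a \<times> 'a \<Rightarrow> real"
  assumes "X \<noteq> {}" and "compact X" and "convex X"
    and "pseudo_continuous_on (X \<times> X) f"
    and "\<And>x. x \<in> X \<Longrightarrow> quasi_concave_on X (\<lambda>y. f (x, y))"
  shows "\<exists>g m M. (\<forall>x\<in>X. is_max_on X (\<lambda>y. f (x, y)) (g x))
            \<and> is_min_on X g m
            \<and> is_max_on X (\<lambda>x. f (x, x)) M
            \<and> m \<le> M"
proof -
  have upper: "upper_pseudo_continuous_on (X \<times> X) f"
    and lower: "lower_pseudo_continuous_on (X \<times> X) f"
    using assms(4) by (auto simp: pseudo_continuous_on_def)
  have "\<exists>m. is_max_on X (\<lambda>y. f (x, y)) m" if "x \<in> X" for x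
    using that
    by (intro upper_pseudo_continuous_attains_max upper_pseudo_continuous_on_compose[OF upper]
        assms continuous_intros) auto
  then obtain g where g: "\<And>x. x \<in> X \<Longrightarrow> is_max_on X (\<lambda>y. f (x, y)) (g x)"
    by metis
  have "lower_pseudo_continuous_on X g"
    using lower g by (rule lower_pseudo_continuous_on_partial_max)
  then obtain m' where "is_max_on X (\<lambda>x. - g x) m'"
    using upper_pseudo_continuous_attains_max[of X "\<lambda>x. - g x"] assms(1,2)
    by (auto simp: lower_pseudo_continuous_on_def)
  then have min: "is_min_on X g (- m')"
    by (force simp: is_max_on_def is_min_on_def)
  have "\<exists>M. is_max_on X (\<lambda>x. f (x, x)) M"
    by (intro upper_pseudo_continuous_attains_max upper_pseudo_continuous_on_compose[OF upper]
        assms continuous_intros) auto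
  then obtain M where M: "is_max_on X (\<lambda>x. f (x, x)) M" by blast
  then obtain a where a: "a \<in> X" "f (a, a) = M" by (auto simp: is_max_on_def)
  \<comment> \<open>The level \<open>M\<close> is the value \<open>f (a, a)\<close>, so lower pseudo-continuity makes the strict superlevel
    sets at \<open>M\<close> open.\<close>
  have "\<exists>x\<in>X. \<forall>y\<in>X. f (x, y) \<le> M"
  proof (rule ky_fan_inequality[OF assms(1-3)])
    fix y assume y: "y \<in> X"
    have "openin (top_of_set (X \<times> X)) {p \<in> X \<times> X. f p > f (a, a)}"
      using a lower by (intro lower_pseudo_continuous_on_openin) auto
    then have "openin (top_of_set X) (X \<inter> (\<lambda>x. (x, y)) -` {p \<in> X \<times> X. f p > f (a, a)})"
      using y by (intro continuous_openin_preimage[of X _ "X \<times> X"] continuous_intros) auto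
    also have "X \<inter> (\<lambda>x. (x, y)) -` {p \<in> X \<times> X. f p > f (a, a)} = {x \<in> X. f (x, y) > M}"
      using y a by auto
    finally show "openin (top_of_set X) {x \<in> X. f (x, y) > M}" .
  qed (use M assms(5) in \<open>auto simp: is_max_on_def\<close>)
  then obtain x where x: "x \<in> X" "\<And>y. y \<in> X \<Longrightarrow> f (x, y) \<le> M" by blast
  with g[OF x(1)] have "g x \<le> M" by (fastforce simp: is_max_on_def)
  with min x have "- m' \<le> M" by (force simp: is_min_on_def)
  with g min M show ?thesis by blast
qed

end
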